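(* Let $m\ge 1$, let $\mathbf X^{m-1},\mathbf X^m\in[V^h]^2$ and $\kappa^{m-1},\kappa^m\in V^h$ be given, let $\widetilde{\mathbf X}^{m+1}\in[V^h]^2$ be the BGN1-predicted curve obtained from $\mathbf X^m$ (see context), and let $(\mathbf X^{m+1},\kappa^{m+1})\in[V^h]^2\times V^h$ be a solution of the BGN/AC scheme, i.e. for all $\varphi^h\in V^h$ and all $\boldsymbol\omega^h\in[V^h]^2$, $$ \begin{aligned} &\frac16\left[\left(\frac{\frac32\mathbf X^{m+1}-2\mathbf X^m+\frac12\mathbf X^{m-1}}{\tau},\varphi^h\mathbf n^{m+1}\right)^h_{\widetilde\Gamma^{m+1}}+\left(\partial_s\kappa^{m+1},\partial_s\varphi^h\right)_{\widetilde\Gamma^{m+1}}\right]\\ &+\frac46\left[\left(\frac{\mathbf X^{m+1}-\mathbf X^{m-1}}{2\tau},\varphi^h\mathbf n^{m}\right)^h_{\Gamma^{m}}+\left(\frac{\partial_s\kappa^{m+1}+\partial_s\kappa^{m-1}}{2},\partial_s\varphi^h\right)_{\Gamma^{m}}\right]\\ &+\frac16\left[\left(\frac{-\frac12\mathbf X^{m+1}+2\mathbf X^m-\frac32\mathbf X^{m-1}}{\tau},\varphi^h\mathbf n^{m-1}\right)^h_{\Gamma^{m-1}}+\left(\partial_s\kappa^{m-1},\partial_s\varphi^h\right)_{\Gamma^{m-1}}\right]=0, \end{aligned} $$ $$ \left(\kappa^{m+1},\widetilde{\mathbf n}^{m+1}\cdot\boldsymbol\omega^h\right)^h_{\widetilde\Gamma^{m+1}}-\left(\partial_s\mathbf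 X^{m+1},\partial_s\boldsymbol\omega^h\right)_{\widetilde\Gamma^{m+1}}=0 . $$ Then $A^{m+1}=A^{m-1}$. Moreover, let $(\mathbf X^m,\kappa^m)_{m\ge0}$ be a sequence in $[V^h]^2\times V^h$ such that, for every $m\ge1$, $(\mathbf X^{m+1},\kappa^{m+1})$ solves the BGN/AC scheme (the two variational equations displayed in this claim, with data $(\mathbf X^{m-1},\kappa^{m-1})$, $(\mathbf X^m,\kappa^m)$ and with $\widetilde{\mathbf X}^{m+1}$ the BGN1-predicted curve obtained from $\mathbf X^m$). If the first step $(\mathbf X^1,\kappa^1)$ is computed from $\mathbf X^0$ by the first-order structure-preserving PFEM (parametric finite element method) of Bao and Zhao (see context), so that $A^1=A^0$, then $A^m=A^0$ for all $m\ge0$.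
   Context: Let $\mathbb I=\mathbb R/\mathbb Z$, $0=\rho_0<\rho_1<\cdots<\rho_N=1$ the uniform partition with $\rho_j=j/N$, $h=1/N$, and let $\tau>0$ be the time step. Set $V^h=\{u\in C(\mathbb I): u|_{[\rho_{j-1},\rho_j]}\in\mathbb P_1\ (1\le j\le N),\ u(0)=u(1)\}$, where $\mathbb P_1$ denotes polynomials of degree at most one. A map $\mathbf Z\in[V^h]^2$ represents the closed polygonal curve $\Gamma_{\mathbf Z}=\mathbf Z(\mathbb I)$ in $\mathbb R^2$; write $\Gamma^m=\Gamma_{\mathbf X^m}$ and $\widetilde\Gamma^{m+1}=\Gamma_{\widetilde{\mathbf X}^{m+1}}$. All curves used as integration domains have nonzero edges, i.e. $|\partial_\rho\mathbf Z|>0$ on each subinterval. Rotation: $(a,b)^\perp=(-b,a)$. Curves are oriented so that $-(\partial_\rho \mathbf Z)^\perp$ points outward (counterclockwise orientation). The enclosed area of $\Gamma^m$ is $A^m=\frac12\int_{\mathbb I}\mathbf X^m\cdot[-\partial_\rho\mathbf X^m]^\perp\,d\rho$. Inner products: for a nodal map $\mathbf Z$ with edges $\mathbf h_j=\mathbf Z(\rho_j)-\mathbf Z(\rho_{j-1})$ and (scalar or vector) functions $u,v$ continuous on each subinterval with possible jumps at the nodes, the mass-lumped inner product is $$(u,v)^h_{\Gamma_{\mathbf Z}}=\frac12\sum_{j=1}^N|\mathbf h_j|\left[(u\cdot v)(\rho_j^-)+(u\cdot v)(\rho_{j-1}^+)\right],$$ with one-sided limits. The arclength derivative on $\Gamma_{\mathbf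 Z}$ is $\partial_s=|\partial_\rho\mathbf Z|^{-1}\partial_\rho$, always computed on the curve indicated by the subscript of the inner product, and $(\partial_su,\partial_sv)_{\Gamma_{\mathbf Z}}=\int_{\mathbb I}|\partial_\rho\mathbf Z|^{-1}\partial_\rho u\cdot\partial_\rho v\,d\rho$. Normals (piecewise constant): $\mathbf n^{k}=-(\partial_\rho\mathbf X^{k})^\perp/|\partial_\rho\mathbf X^{k}|$ for $k=m-1,m$ (usual outward unit normals); $\widetilde{\mathbf n}^{m+1}=-(\partial_\rho\widetilde{\mathbf X}^{m+1})^\perp/|\partial_\rho\widetilde{\mathbf X}^{m+1}|$; and the structure-preserving normal used in the scheme at level $m+1$ is $$\mathbf n^{m+1}=-\frac{(\partial_\rho\mathbf X^{m+1})^\perp}{|\partial_\rho\widetilde{\mathbf X}^{m+1}|}.$$ (Inside the step $m\to m+1$ the symbol $\mathbf n^{m+1}$ has this meaning, while $\mathbf n^m$ and $\mathbf n^{m-1}$ are the usual unit normals of $\Gamma^m$ and $\Gamma^{m-1}$.) Predictor (BGN1 step, the classical first-order Barrett–Garcke–Nürnberg scheme): $\widetilde{\mathbf X}^{m+1}\in[V^h]^2$, together with some $\widetilde\kappa^{m+1}\in V^h$, satisfies for all $\varphi^h\in V^h$, $\boldsymbol\omega^h\in[V^h]^2$: $$\left(\frac{\widetilde{\mathbf X}^{m+1}-\mathbf X^m}{\tau},\varphi^h\mathbf n^m\right)^h_{\Gamma^m}+\left(\partial_s\widetilde\kappa^{m+1},\partial_s\varphi^h\right)_{\Gamma^m}=0,\qquad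 \left(\widetilde\kappa^{m+1},\mathbf n^m\cdot\boldsymbol\omega^h\right)^h_{\Gamma^m}-\left(\partial_s\widetilde{\mathbf X}^{m+1},\partial_s\boldsymbol\omega^h\right)_{\Gamma^m}=0.$$ Starting step (first-order structure-preserving PFEM of Bao and Zhao, based on linear interpolation between two consecutive time levels): given $\mathbf X^0\in[V^h]^2$, $(\mathbf X^1,\kappa^1)\in[V^h]^2\times V^h$ satisfies for all $\varphi^h\in V^h$, $\boldsymbol\omega^h\in[V^h]^2$: $$\left(\frac{\mathbf X^{1}-\mathbf X^0}{\tau},\varphi^h\mathbf n^{\frac12}\right)^h_{\Gamma^0}+\left(\partial_s\kappa^{1},\partial_s\varphi^h\right)_{\Gamma^0}=0,\qquad \left(\kappa^{1},\mathbf n^{\frac12}\cdot\boldsymbol\omega^h\right)^h_{\Gamma^0}-\left(\partial_s\mathbf X^{1},\partial_s\boldsymbol\omega^h\right)_{\Gamma^0}=0,$$ where $\mathbf n^{\frac12}=-\dfrac{(\partial_\rho\mathbf X^0+\partial_\rho\mathbf X^1)^\perp}{2|\partial_\rho\mathbf X^0|}$. This step gives $A^1=A^0$. *)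

theory Defs
  imports "HOL-Analysis.Analysis"
begin

definition node :: "nat \<Rightarrow> nat \<Rightarrow> real" where
  "node N j = real j / real N"

text \<open>Functions on \<open>\<real>/\<int>\<close> are encoded as 1-periodic functions on the real line.\<close>

definition Vh :: "nat \<Rightarrow> (real \<Rightarrow> real) set" where
  "Vh N = {u. continuous_on UNIV u \<and> (\<forall>x. u (x + 1) = u x) \<and>
     (\<forall>j\<in>{1..N}. \<exists>a b. \<forall>x\<in>{node N (j - 1)..node N j}. u x = a + b * x)}"

definition Vh2 :: "nat \<Rightarrow> (real \<Rightarrow> real^2) set" where
  "Vh2 N = {Z. \<forall>i. (\<lambda>x. Z x $ i) \<in> Vh N}"

text \<open>The value of \<open>d_rho\<close> at a node, where the function may have a kink, is unspecified.
  Below it enters only under integrals and one-sided limits, which do not see it.\<close>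

definition d_rho :: "(real \<Rightarrow> 'a::real_normed_vector) \<Rightarrow> real \<Rightarrow> 'a" where
  "d_rho u x = vector_derivative u (at x)"

definition perp :: "real^2 \<Rightarrow> real^2" where
  "perp v = vector [- v $ 2, v $ 1]"

definition nonzero_edges :: "nat \<Rightarrow> (real \<Rightarrow> real^2) \<Rightarrow> bool" where
  "nonzero_edges N Z \<longleftrightarrow>
     (\<forall>j\<in>{1..N}. \<forall>x\<in>{node N (j - 1)<..<node N j}. norm (d_rho Z x) > 0)"

text \<open>Signed area, positive for counterclockwise curves; for these \<open>- perp (d_rho Z x)\<close> points outward.\<close>

definition area :: "(real \<Rightarrow> real^2) \<Rightarrow> real" where
  "area Z = 1/2 * integral {0..1} (\<lambda>x. Z x \<bullet> perp (- d_rho Z x))"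

definition lumped :: "nat \<Rightarrow> (real \<Rightarrow> real^2) \<Rightarrow> (real \<Rightarrow> 'a::real_inner) \<Rightarrow> (real \<Rightarrow> 'a) \<Rightarrow> real" where
  "lumped N Z u v = 1/2 * (\<Sum>j=1..N. norm (Z (node N j) - Z (node N (j - 1))) *
     (Lim (at_left (node N j)) (\<lambda>x. u x \<bullet> v x) +
      Lim (at_right (node N (j - 1))) (\<lambda>x. u x \<bullet> v x)))"

definition d_s :: "(real \<Rightarrow> real^2) \<Rightarrow> (real \<Rightarrow> 'a::real_normed_vector) \<Rightarrow> real \<Rightarrow> 'a" where
  "d_s Z u x = d_rho u x /\<^sub>R norm (d_rho Z x)"

text \<open>The \<open>L\<^sup>2\<close> product over the curve, with arclength element \<open>norm (d_rho Z x) dx\<close>.\<close>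

definition curve_inner :: "(real \<Rightarrow> real^2) \<Rightarrow> (real \<Rightarrow> 'a::real_inner) \<Rightarrow> (real \<Rightarrow> 'a) \<Rightarrow> real" where
  "curve_inner Z f g = integral {0..1} (\<lambda>x. (f x \<bullet> g x) * norm (d_rho Z x))"

lemma curve_inner_d_s:
  "curve_inner Z (d_s Z u) (d_s Z v) =
     integral {0..1} (\<lambda>x. inverse (norm (d_rho Z x)) * (d_rho u x \<bullet> d_rho v x))"
proof -
  have "(d_s Z u x \<bullet> d_s Z v x) * norm (d_rho Z x) =
      inverse (norm (d_rho Z x)) * (d_rho u x \<bullet> d_rho v x)" for x
    by (cases "norm (d_rho Z x) = 0") (simp_all add: d_s_def)
  then show ?thesis
    by (simp add: curve_inner_def)
qed

text \<open>The direction comes from the edges of \<open>Z\<close>, the length scale from those of \<open>W\<close>; this is a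
  unit normal only for \<open>W = Z\<close>.\<close>

definition scaled_normal :: "(real \<Rightarrow> real^2) \<Rightarrow> (real \<Rightarrow> real^2) \<Rightarrow> real \<Rightarrow> real^2" where
  "scaled_normal W Z x = - (perp (d_rho Z x) /\<^sub>R norm (d_rho W x))"

abbreviation unit_normal :: "(real \<Rightarrow> real^2) \<Rightarrow> real \<Rightarrow> real^2" where
  "unit_normal Z \<equiv> scaled_normal Z Z"

definition half_normal :: "(real \<Rightarrow> real^2) \<Rightarrow> (real \<Rightarrow> real^2) \<Rightarrow> real \<Rightarrow> real^2" where
  "half_normal X0 X1 x = - (perp (d_rho X0 x + d_rho X1 x) /\<^sub>R (2 * norm (d_rho X0 x)))"

definition bgn1_predicted ::
    "nat \<Rightarrow> real \<Rightarrow> (real \<Rightarrow> real^2) \<Rightarrow> (real \<Rightarrow> real^2) \<Rightarrow> bool" where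
  "bgn1_predicted N \<tau> X Xt \<longleftrightarrow> Xt \<in> Vh2 N \<and> (\<exists>\<kappa>t\<in>Vh N.
     (\<forall>\<phi>\<in>Vh N.
        lumped N X (\<lambda>x. (Xt x - X x) /\<^sub>R \<tau>) (\<lambda>x. \<phi> x *\<^sub>R unit_normal X x)
        + curve_inner X (d_s X \<kappa>t) (d_s X \<phi>) = 0) \<and>
     (\<forall>\<omega>\<in>Vh2 N.
        lumped N X \<kappa>t (\<lambda>x. unit_normal X x \<bullet> \<omega> x)
        - curve_inner X (d_s X Xt) (d_s X \<omega>) = 0))"

definition sp_pfem_step ::
    "nat \<Rightarrow> real \<Rightarrow> (real \<Rightarrow> real^2) \<Rightarrow> (real \<Rightarrow> real^2) \<Rightarrow> (real \<Rightarrow> real) \<Rightarrow> bool" where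
  "sp_pfem_step N \<tau> X0 X1 \<kappa>1 \<longleftrightarrow> X1 \<in> Vh2 N \<and> \<kappa>1 \<in> Vh N \<and>
     (\<forall>\<phi>\<in>Vh N.
        lumped N X0 (\<lambda>x. (X1 x - X0 x) /\<^sub>R \<tau>) (\<lambda>x. \<phi> x *\<^sub>R half_normal X0 X1 x)
        + curve_inner X0 (d_s X0 \<kappa>1) (d_s X0 \<phi>) = 0) \<and>
     (\<forall>\<omega>\<in>Vh2 N.
        lumped N X0 \<kappa>1 (\<lambda>x. half_normal X0 X1 x \<bullet> \<omega> x)
        - curve_inner X0 (d_s X0 X1) (d_s X0 \<omega>) = 0)"

text \<open>\<open>Xp\<close>, \<open>X\<close>, \<open>Xn\<close> are the previous, current and next polygons and \<open>Xt\<close> is the predicted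
  one; the curvature at the current level does not enter the scheme.\<close>

definition bgn_ac_step ::
    "nat \<Rightarrow> real \<Rightarrow> (real \<Rightarrow> real^2) \<Rightarrow> (real \<Rightarrow> real) \<Rightarrow> (real \<Rightarrow> real^2) \<Rightarrow>
     (real \<Rightarrow> real^2) \<Rightarrow> (real \<Rightarrow> real^2) \<Rightarrow> (real \<Rightarrow> real) \<Rightarrow> bool" where
  "bgn_ac_step N \<tau> Xp \<kappa>p X Xt Xn \<kappa>n \<longleftrightarrow> Xn \<in> Vh2 N \<and> \<kappa>n \<in> Vh N \<and>
     (\<forall>\<phi>\<in>Vh N.
        1/6 * (lumped N Xt (\<lambda>x. ((3/2) *\<^sub>R Xn x - 2 *\<^sub>R X x + (1/2) *\<^sub>R Xp x) /\<^sub>R \<tau>)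
                 (\<lambda>x. \<phi> x *\<^sub>R scaled_normal Xt Xn x)
               + curve_inner Xt (d_s Xt \<kappa>n) (d_s Xt \<phi>))
        + 4/6 * (lumped N X (\<lambda>x. (Xn x - Xp x) /\<^sub>R (2 * \<tau>))
                   (\<lambda>x. \<phi> x *\<^sub>R unit_normal X x)
                 + curve_inner X (\<lambda>x. (d_s X \<kappa>n x + d_s X \<kappa>p x) / 2) (d_s X \<phi>))
        + 1/6 * (lumped N Xp (\<lambda>x. (- (1/2) *\<^sub>R Xn x + 2 *\<^sub>R X x - (3/2) *\<^sub>R Xp x) /\<^sub>R \<tau>)
                   (\<lambda>x. \<phi> x *\<^sub>R unit_normal Xp x)
                 + curve_inner Xp (d_s Xp \<kappa>p) (d_s Xp \<phi>)) = 0) \<and>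
     (\<forall>\<omega>\<in>Vh2 N.
        lumped N Xt \<kappa>n (\<lambda>x. unit_normal Xt x \<bullet> \<omega> x)
        - curve_inner Xt (d_s Xt Xn) (d_s Xt \<omega>) = 0)"

end

theory Submission
  imports Defs
begin

text \<open>Testing the scheme with the constant function \<open>1\<close> removes every curvature term. What is left is
  built from the bilinear form \<open>mixed_area N U W\<close>, the trapezoidal value of
  \<open>\<integral> U \<cdot> (- perp W')\<close>: each edge length \<open>|h\<^sub>j|\<close> in the mass-lumped product is \<open>1/N\<close> times the
  speed that scales the normal, so the curve that carries the product drops out
  (\<open>lumped_scaled_normal\<close>). This is where the structure-preserving normal matters: it takes its
  direction from the new curve and its length scale from the integration curve.

  On closed polygons \<open>mixed_area\<close> is symmetric by summation by parts (\<open>mixed_area_commute\<close>), and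
  twice the enclosed area is its quadratic form (\<open>area_eq_mixed_area\<close>). Writing \<open>M\<close> for this form
  and \<open>p\<close>, \<open>c\<close>, \<open>n\<close> for the previous, current and next polygon, the tested scheme times \<open>6 \<tau>\<close> reads
  \<open>M (3/2 n - 2 c + 1/2 p) n + 2 M (n - p) c + M (- 1/2 n + 2 c - 3/2 p) p = 0\<close>.
  The weights \<open>1/6\<close>, \<open>4/6\<close>, \<open>1/6\<close> of Simpson's rule integrate exactly the derivative of the area along the
  quadratic interpolant in time. Accordingly, all terms except \<open>3/2 (M n n - M p p)\<close> cancel by
  symmetry, so the area of \<open>n\<close> is that of \<open>p\<close>. The starting step, from \<open>p\<close>
  to \<open>n\<close>, gives in the same way \<open>M (n - p) ((p + n) / 2) = 0\<close>, whose left-hand side is by symmetry the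
  difference of the two areas; the sequence
  statement follows by induction in steps of two.\<close>

section \<open>Polygonal curves on the uniform partition\<close>

definition edge :: "nat \<Rightarrow> (real \<Rightarrow> real^2) \<Rightarrow> nat \<Rightarrow> real^2" where
  "edge N Z j = Z (node N j) - Z (node N (j - 1))"

lemma node_0: "node N 0 = 0"
  by (simp add: node_def)

lemma node_N: "N \<ge> 1 \<Longrightarrow> node N N = 1"
  by (simp add: node_def)

lemma node_diff: "j \<ge> 1 \<Longrightarrow> node N j - node N (j - 1) = 1 / real N"
  by (simp add: node_def of_nat_diff diff_divide_distrib[symmetric])

lemma node_less: "N \<ge> 1 \<Longrightarrow> j \<ge> 1 \<Longrightarrow> node N (j - 1) < node N j"
  using node_diff[of j N] by (smt (verit) divide_pos_pos of_nat_0_less_iff less_le_trans zero_less_one)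

lemma Vh2_affine:
  assumes "Z \<in> Vh2 N" "N \<ge> 1" "j \<in> {1..N}" "x \<in> {node N (j - 1)..node N j}"
  shows "Z x = Z (node N (j - 1)) + (real N * (x - node N (j - 1))) *\<^sub>R edge N Z j"
proof -
  have "Z x $ i = (Z (node N (j - 1)) + (real N * (x - node N (j - 1))) *\<^sub>R edge N Z j) $ i" for i
  proof -
    have "(\<lambda>x. Z x $ i) \<in> Vh N"
      using assms(1) by (auto simp: Vh2_def)
    then obtain a b where ab: "\<forall>x\<in>{node N (j - 1)..node N j}. Z x $ i = a + b * x"
      using assms(3) unfolding Vh_def by blast
    have le: "node N (j - 1) \<le> node N j"
      using node_less[of N j] assms by auto
    have "edge N Z j $ i = b * (node N j - node N (j - 1))"
      using ab le by (simp add: edge_def algebra_simps)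
    also have "\<dots> = b / real N"
      using node_diff[of j N] assms by simp
    finally show ?thesis
      using ab le assms by (simp add: field_simps)
  qed
  then show ?thesis
    by (simp add: vec_eq_iff)
qed

lemma d_rho_eq_edge:
  assumes "Z \<in> Vh2 N" "N \<ge> 1" "j \<in> {1..N}" "x \<in> {node N (j - 1)<..<node N j}"
  shows "d_rho Z x = real N *\<^sub>R edge N Z j"
proof -
  let ?p = "\<lambda>x. Z (node N (j - 1)) + (real N * (x - node N (j - 1))) *\<^sub>R edge N Z j"
  have deriv: "(?p has_vector_derivative real N *\<^sub>R edge N Z j) (at x)"
    by (auto intro!: derivative_eq_intros simp: has_vector_derivative_def)
  have affine: "?p y = Z y" if "y \<in> {node N (j - 1)<..<node N j}" for y
    using that by (intro Vh2_affine[OF assms(1-3), symmetric]) auto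
  have "(Z has_vector_derivative real N *\<^sub>R edge N Z j) (at x)"
    by (rule has_vector_derivative_transform_within_open[OF deriv _ assms(4)])
      (use affine in simp_all)
  then show ?thesis
    unfolding d_rho_def by (rule vector_derivative_at)
qed

lemma edge_nonzero:
  assumes "Z \<in> Vh2 N" "N \<ge> 1" "j \<in> {1..N}" "nonzero_edges N Z"
  shows "edge N Z j \<noteq> 0"
proof -
  obtain x where x: "x \<in> {node N (j - 1)<..<node N j}"
    using dense[OF node_less[of N j]] assms by auto
  then have "norm (d_rho Z x) > 0"
    using assms unfolding nonzero_edges_def by blast
  then show ?thesis
    using d_rho_eq_edge[OF assms(1-3) x] by auto
qed

lemma Vh2_closed:
  assumes "Z \<in> Vh2 N" "N \<ge> 1"
  shows "Z (node N N) = Z (node N 0)"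
proof -
  have "Z (0 + 1) $ i = Z 0 $ i" for i
    using assms unfolding Vh2_def Vh_def by blast
  then show ?thesis
    using assms by (simp add: node_0 node_N vec_eq_iff)
qed

lemma Vh2_continuous:
  assumes "Z \<in> Vh2 N"
  shows "isCont Z x"
proof -
  have "isCont (\<lambda>x. Z x $ i) x" for i
    using assms unfolding Vh2_def Vh_def by (auto simp: continuous_on_eq_continuous_at)
  then show ?thesis
    unfolding isCont_def by (rule vec_tendstoI)
qed

lemma const_in_Vh: "(\<lambda>x. c) \<in> Vh N"
proof -
  have "\<exists>a b. \<forall>x\<in>S. c = a + b * x" for S
    by (rule exI[of _ c], rule exI[of _ 0]) simp
  then show ?thesis
    by (simp add: Vh_def)
qed

section \<open>The mixed area of two closed polygons\<close>

definition mixed_area :: "nat \<Rightarrow> (real \<Rightarrow> real^2) \<Rightarrow> (real \<Rightarrow> real^2) \<Rightarrow> real" where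
  "mixed_area N U W = 1/2 * (\<Sum>j=1..N.
     (U (node N j) + U (node N (j - 1))) \<bullet> (- perp (edge N W j)))"

lemma linear_perp: "linear perp"
  by (rule linearI) (simp_all add: perp_def vec_eq_iff forall_2)

lemmas perp_linear_simps =
  linear_add[OF linear_perp] linear_diff[OF linear_perp] linear_neg[OF linear_perp]
  linear_scale[OF linear_perp]

lemma inner_perp_skew: "u \<bullet> perp v = - (v \<bullet> perp u)"
  by (simp add: perp_def inner_vec_def sum_2)

lemma inner_perp_self: "u \<bullet> perp u = 0"
  using inner_perp_skew[of u u] by simp

lemma mixed_area_add_left: "mixed_area N (\<lambda>x. U x + V x) W = mixed_area N U W + mixed_area N V W"
  unfolding mixed_area_def distrib_left[symmetric] sum.distrib[symmetric]
  by (simp add: algebra_simps)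

lemma mixed_area_scale_left: "mixed_area N (\<lambda>x. c *\<^sub>R U x) W = c * mixed_area N U W"
  unfolding mixed_area_def sum_distrib_left
  by (rule sum.cong) (simp_all add: algebra_simps)

lemma mixed_area_diff_left: "mixed_area N (\<lambda>x. U x - V x) W = mixed_area N U W - mixed_area N V W"
  using mixed_area_add_left[of N U "\<lambda>x. (-1) *\<^sub>R V x" W] mixed_area_scale_left[of N "-1" V W]
  by simp

lemmas mixed_area_linear_left =
  mixed_area_add_left mixed_area_diff_left mixed_area_scale_left

text \<open>Summation by parts: with the skew form \<open>\<omega> u w = u \<bullet> perp w\<close>, the difference of the two
  summands on edge \<open>j\<close> is the increment of \<open>- 2 \<omega> U W\<close> along that edge, and increments sum to zero
  around a closed polygon.\<close>

lemma mixed_area_commute: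
  assumes "U (node N N) = U (node N 0)" "W (node N N) = W (node N 0)"
  shows "mixed_area N U W = mixed_area N W U"
proof -
  define f where "f j = U (node N j) \<bullet> perp (W (node N j))" for j
  have *: "(U (node N j) + U (node N (j - 1))) \<bullet> (- perp (edge N W j))
      - (W (node N j) + W (node N (j - 1))) \<bullet> (- perp (edge N U j))
      = - 2 * (f j - f (j - 1))" for j
    unfolding f_def edge_def perp_linear_simps
    using inner_perp_skew[of "W (node N j)" "U (node N j)"]
      inner_perp_skew[of "W (node N j)" "U (node N (j - 1))"]
      inner_perp_skew[of "W (node N (j - 1))" "U (node N j)"]
      inner_perp_skew[of "W (node N (j - 1))" "U (node N (j - 1))"]
    by (simp add: inner_simps)
  have "mixed_area N U W - mixed_area N W U = 1/2 * (\<Sum>j=1..N. - 2 * (f j - f (j - 1)))"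
    unfolding mixed_area_def *[symmetric] sum_subtractf by (simp add: algebra_simps)
  also have "\<dots> = - (\<Sum>j=1..N. f j - f (j - 1))"
    unfolding sum_distrib_left[symmetric] by simp
  also have "(\<Sum>j=1..N. f j - f (j - 1)) = f N - f 0"
    by (induction N) simp_all
  also have "f N = f 0"
    unfolding f_def assms ..
  finally show ?thesis
    by simp
qed

text \<open>The ordering of the end points is carried along because combining integrals over adjacent
  intervals requires it.\<close>

lemma has_integral_sum_partition:
  fixes f :: "real \<Rightarrow> real" and p :: "nat \<Rightarrow> real"
  assumes "\<And>j. 1 \<le> j \<Longrightarrow> j \<le> n \<Longrightarrow> p (j - 1) \<le> p j"
    and "\<And>j. 1 \<le> j \<Longrightarrow> j \<le> n \<Longrightarrow> (f has_integral I j) {p (j - 1)..p j}"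
  shows "p 0 \<le> p n \<and> (f has_integral (\<Sum>j=1..n. I j)) {p 0..p n}"
  using assms
proof (induction n)
  case 0
  then show ?case by (simp add: has_integral_refl)
next
  case (Suc n)
  then have "p 0 \<le> p n" "(f has_integral (\<Sum>j=1..n. I j)) {p 0..p n}"
    by auto
  moreover have "p n \<le> p (Suc n)" "(f has_integral I (Suc n)) {p n..p (Suc n)}"
    using Suc.prems[of "Suc n"] by auto
  ultimately show ?case
    by (auto intro: has_integral_combine)
qed

text \<open>The trapezoidal rule is exact here because the integrand is even constant on each edge: moving
  along the edge changes \<open>Z x\<close> by a multiple of the edge vector, which is orthogonal to its
  rotation.\<close>

lemma area_eq_mixed_area:
  assumes "Z \<in> Vh2 N" "N \<ge> 1"
  shows "area Z = 1/2 * mixed_area N Z Z"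
proof -
  let ?f = "\<lambda>x. Z x \<bullet> perp (- d_rho Z x)"
  define I where "I j = Z (node N (j - 1)) \<bullet> (- perp (edge N Z j))" for j
  have piece: "(?f has_integral I j) {node N (j - 1)..node N j}" if "1 \<le> j" "j \<le> N" for j
  proof -
    have j: "j \<in> {1..N}" using that by simp
    have "?f x = real N * I j" if x: "x \<in> box (node N (j - 1)) (node N j)" for x
    proof -
      have "x \<in> {node N (j - 1)..node N j}" "x \<in> {node N (j - 1)<..<node N j}"
        using x by (auto simp: mem_box)
      then show ?thesis
        unfolding I_def d_rho_eq_edge[OF assms j \<open>x \<in> {_<..<_}\<close>]
          Vh2_affine[OF assms j \<open>x \<in> {_.._}\<close>]
        by (simp add: perp_linear_simps inner_add_left inner_perp_self)
    qed
    moreover have "((\<lambda>x. real N * I j) has_integral I j) {node N (j - 1)..node N j}"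
      using has_integral_const_real[of "real N * I j" "node N (j - 1)" "node N j"]
        node_diff[of j N] node_less[of N j] that assms by simp
    ultimately show ?thesis
      using has_integral_spike_interior[of "\<lambda>x. real N * I j" "I j" "node N (j - 1)" "node N j" ?f]
      by (simp add: cbox_interval)
  qed
  have "(?f has_integral (\<Sum>j=1..N. I j)) {node N 0..node N N}"
    using has_integral_sum_partition[of N "node N" ?f I] piece node_less[of N] assms
    by (auto intro: less_imp_le)
  then have "integral {0..1} ?f = (\<Sum>j=1..N. I j)"
    using assms by (simp add: node_0 node_N integral_unique)
  also have "\<dots> = mixed_area N Z Z"
    unfolding mixed_area_def sum_distrib_left
  proof (rule sum.cong)
    fix j
    have "Z (node N j) \<bullet> perp (edge N Z j) = Z (node N (j - 1)) \<bullet> perp (edge N Z j)"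
      using inner_perp_self[of "edge N Z j"] by (simp add: edge_def inner_diff_left)
    then show "I j = 1 / 2 * ((Z (node N j) + Z (node N (j - 1))) \<bullet> (- perp (edge N Z j)))"
      by (simp add: I_def inner_add_left)
  qed simp
  finally show ?thesis
    by (simp add: area_def)
qed

section \<open>Mass-lumped products against normals\<close>

text \<open>For a normal of the stated form the edge length of the integration curve \<open>Z\<close> cancels.
  Only the values in the open subintervals matter, since the product is made of one-sided limits.\<close>

lemma lumped_edge_normal:
  assumes "N \<ge> 1" "\<And>x. isCont U x" "\<And>j. j \<in> {1..N} \<Longrightarrow> edge N Z j \<noteq> 0"
    and v: "\<And>j x. j \<in> {1..N} \<Longrightarrow> x \<in> {node N (j - 1)<..<node N j} \<Longrightarrow>
      v x = - perp (edge N W j) /\<^sub>R norm (edge N Z j)"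
  shows "lumped N Z U v = mixed_area N U W"
proof -
  have "norm (Z (node N j) - Z (node N (j - 1))) *
      (Lim (at_left (node N j)) (\<lambda>x. U x \<bullet> v x) + Lim (at_right (node N (j - 1))) (\<lambda>x. U x \<bullet> v x))
      = (U (node N j) + U (node N (j - 1))) \<bullet> (- perp (edge N W j))" if j: "j \<in> {1..N}" for j
  proof -
    define c where "c = - perp (edge N W j) /\<^sub>R norm (edge N Z j)"
    have less: "node N (j - 1) < node N j"
      using node_less assms(1) j by auto
    have lim: "((\<lambda>x. U x \<bullet> c) \<longlongrightarrow> U y \<bullet> c) (at y within S)" for y S
      using assms(2)[of y] unfolding isCont_def
      by (intro tendsto_intros) (rule tendsto_within_subset, auto)
    have "((\<lambda>x. U x \<bullet> v x) \<longlongrightarrow> U (node N j) \<bullet> c) (at_left (node N j))"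
      by (rule Lim_transform_eventually[OF lim])
        (use less v[OF j] in \<open>auto simp: eventually_at_left c_def intro!: exI[of _ "node N (j - 1)"]\<close>)
    then have L: "Lim (at_left (node N j)) (\<lambda>x. U x \<bullet> v x) = U (node N j) \<bullet> c"
      by (intro tendsto_Lim) simp_all
    have "((\<lambda>x. U x \<bullet> v x) \<longlongrightarrow> U (node N (j - 1)) \<bullet> c) (at_right (node N (j - 1)))"
      by (rule Lim_transform_eventually[OF lim])
        (use less v[OF j] in \<open>auto simp: eventually_at_right c_def intro!: exI[of _ "node N j"]\<close>)
    then have R: "Lim (at_right (node N (j - 1))) (\<lambda>x. U x \<bullet> v x) = U (node N (j - 1)) \<bullet> c"
      by (intro tendsto_Lim) simp_all
    have "norm (edge N Z j) *\<^sub>R c = - perp (edge N W j)"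
      using assms(3)[OF j] by (simp add: c_def)
    then show ?thesis
      unfolding L R edge_def[symmetric]
      by (metis inner_add_left inner_scaleR_right)
  qed
  then show ?thesis
    by (simp add: lumped_def mixed_area_def)
qed

text \<open>The factor \<open>N\<close> relating derivatives to edges occurs both in the rotated derivative of \<open>W\<close> and
  in the speed of \<open>Z\<close>, so it cancels. The factor \<open>1\<close> is the constant test function.\<close>

lemma lumped_scaled_normal:
  assumes "N \<ge> 1" "Z \<in> Vh2 N" "nonzero_edges N Z" "W \<in> Vh2 N" "\<And>x. isCont U x"
  shows "lumped N Z U (\<lambda>x. 1 *\<^sub>R scaled_normal Z W x) = mixed_area N U W"
  using assms
  by (intro lumped_edge_normal)
    (auto simp: edge_nonzero scaled_normal_def d_rho_eq_edge perp_linear_simps)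

lemma lumped_half_normal:
  assumes "N \<ge> 1" "Z \<in> Vh2 N" "nonzero_edges N Z" "W \<in> Vh2 N" "\<And>x. isCont U x"
  shows "lumped N Z U (\<lambda>x. 1 *\<^sub>R half_normal Z W x)
    = mixed_area N U (\<lambda>x. (1/2) *\<^sub>R (Z x + W x))"
proof -
  have "edge N (\<lambda>x. (1/2) *\<^sub>R (Z x + W x)) j = (1/2) *\<^sub>R (edge N Z j + edge N W j)" for j
    by (simp add: edge_def algebra_simps)
  moreover have "- ((r *\<^sub>R a + r *\<^sub>R b) /\<^sub>R (2 * (r * l))) = - ((1/2) *\<^sub>R (a + b)) /\<^sub>R l"
    if "r \<noteq> 0" for r l and a b :: "real^2"
    using that by (simp add: vec_eq_iff divide_simps) (simp add: algebra_simps)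
  ultimately show ?thesis
    using assms
    by (intro lumped_edge_normal)
      (simp_all add: edge_nonzero half_normal_def d_rho_eq_edge perp_linear_simps
        del: scaleR_add_right)
qed

lemma curve_inner_d_s_const: "curve_inner Z f (d_s Z (\<lambda>x. c)) = 0"
  by (simp add: curve_inner_def d_s_def d_rho_def)

section \<open>Area conservation\<close>

lemma area_bgn_ac_step:
  assumes "N \<ge> 1" "\<tau> > 0" "Xp \<in> Vh2 N" "X \<in> Vh2 N" "Xt \<in> Vh2 N"
    and "nonzero_edges N Xp" "nonzero_edges N X" "nonzero_edges N Xt"
    and step: "bgn_ac_step N \<tau> Xp \<kappa>p X Xt Xn \<kappa>n"
  shows "area Xn = area Xp"
proof -
  let ?M = "mixed_area N"
  have Xn: "Xn \<in> Vh2 N"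
    using step by (simp add: bgn_ac_step_def)
  note tested = step[unfolded bgn_ac_step_def, THEN conjunct2, THEN conjunct2, THEN conjunct1]
  note cont = Vh2_continuous[OF assms(3)] Vh2_continuous[OF assms(4)] Vh2_continuous[OF Xn]
  have "1/6 * lumped N Xt (\<lambda>x. ((3/2) *\<^sub>R Xn x - 2 *\<^sub>R X x + (1/2) *\<^sub>R Xp x) /\<^sub>R \<tau>)
          (\<lambda>x. 1 *\<^sub>R scaled_normal Xt Xn x)
      + 4/6 * lumped N X (\<lambda>x. (Xn x - Xp x) /\<^sub>R (2 * \<tau>)) (\<lambda>x. 1 *\<^sub>R unit_normal X x)
      + 1/6 * lumped N Xp (\<lambda>x. (- (1/2) *\<^sub>R Xn x + 2 *\<^sub>R X x - (3/2) *\<^sub>R Xp x) /\<^sub>R \<tau>)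
          (\<lambda>x. 1 *\<^sub>R unit_normal Xp x) = 0"
    using bspec[OF tested const_in_Vh[of 1]] by (simp only: curve_inner_d_s_const add_0_right)
  then have "1/6 * ?M (\<lambda>x. ((3/2) *\<^sub>R Xn x - 2 *\<^sub>R X x + (1/2) *\<^sub>R Xp x) /\<^sub>R \<tau>) Xn
      + 4/6 * ?M (\<lambda>x. (Xn x - Xp x) /\<^sub>R (2 * \<tau>)) X
      + 1/6 * ?M (\<lambda>x. (- (1/2) *\<^sub>R Xn x + 2 *\<^sub>R X x - (3/2) *\<^sub>R Xp x) /\<^sub>R \<tau>) Xp = 0"
    using assms Xn
    by (subst (asm) (1 2 3) lumped_scaled_normal) (auto intro!: continuous_intros cont)
  then have "inverse \<tau> *
      (1/6 * (3/2 * ?M Xn Xn - 2 * ?M X Xn + 1/2 * ?M Xp Xn) + 1/3 * (?M Xn X - ?M Xp X)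
      + 1/6 * (- (1/2) * ?M Xn Xp + 2 * ?M X Xp - 3/2 * ?M Xp Xp)) = 0"
    unfolding mixed_area_linear_left inverse_mult_distrib by (simp add: algebra_simps)
  then have "1/6 * (3/2 * ?M Xn Xn - 2 * ?M X Xn + 1/2 * ?M Xp Xn) + 1/3 * (?M Xn X - ?M Xp X)
      + 1/6 * (- (1/2) * ?M Xn Xp + 2 * ?M X Xp - 3/2 * ?M Xp Xp) = 0"
    using \<open>\<tau> > 0\<close> by simp
  moreover have "?M X Xn = ?M Xn X" "?M Xp Xn = ?M Xn Xp" "?M X Xp = ?M Xp X"
    using assms Xn by (auto intro!: mixed_area_commute Vh2_closed)
  ultimately have "?M Xn Xn = ?M Xp Xp"
    by (simp add: field_simps)
  then show ?thesis
    using assms Xn by (simp add: area_eq_mixed_area)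
qed

lemma area_sp_pfem_step:
  assumes "N \<ge> 1" "\<tau> > 0" "X0 \<in> Vh2 N" "nonzero_edges N X0"
    and step: "sp_pfem_step N \<tau> X0 X1 \<kappa>1"
  shows "area X1 = area X0"
proof -
  let ?M = "mixed_area N"
  let ?mid = "\<lambda>x. (1/2) *\<^sub>R (X0 x + X1 x)"
  have X1: "X1 \<in> Vh2 N"
    using step by (simp add: sp_pfem_step_def)
  note tested = step[unfolded sp_pfem_step_def, THEN conjunct2, THEN conjunct2, THEN conjunct1]
  note cont = Vh2_continuous[OF assms(3)] Vh2_continuous[OF X1]
  have "lumped N X0 (\<lambda>x. (X1 x - X0 x) /\<^sub>R \<tau>) (\<lambda>x. 1 *\<^sub>R half_normal X0 X1 x) = 0"
    using bspec[OF tested const_in_Vh[of 1]] by (simp only: curve_inner_d_s_const add_0_right)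
  then have "?M (\<lambda>x. (X1 x - X0 x) /\<^sub>R \<tau>) ?mid = 0"
    using assms X1
    by (subst (asm) lumped_half_normal) (auto intro!: continuous_intros cont)
  then have "?M X1 ?mid = ?M X0 ?mid"
    using \<open>\<tau> > 0\<close> unfolding mixed_area_linear_left by simp
  moreover have "?M X1 ?mid = ?M ?mid X1" "?M X0 ?mid = ?M ?mid X0"
    using Vh2_closed[of X0 N] Vh2_closed[of X1 N] assms X1 by (auto intro!: mixed_area_commute)
  ultimately have "?M X0 X1 + ?M X1 X1 = ?M X0 X0 + ?M X1 X0"
    unfolding mixed_area_linear_left by simp
  moreover have "?M X0 X1 = ?M X1 X0"
    using assms X1 by (auto intro!: mixed_area_commute Vh2_closed)
  ultimately show ?thesis
    using assms X1 by (simp add: area_eq_mixed_area)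
qed

theorem theorem1:
  fixes N :: nat and \<tau> :: real
  assumes "N \<ge> 1" and "\<tau> > 0"
  shows
    "(\<forall>Xp X Xt Xn \<kappa>p \<kappa> \<kappa>n.
        Xp \<in> Vh2 N \<and> X \<in> Vh2 N \<and> \<kappa>p \<in> Vh N \<and> \<kappa> \<in> Vh N \<and>
        nonzero_edges N Xp \<and> nonzero_edges N X \<and> nonzero_edges N Xt \<and>
        bgn1_predicted N \<tau> X Xt \<and>
        bgn_ac_step N \<tau> Xp \<kappa>p X Xt Xn \<kappa>n
        \<longrightarrow> area Xn = area Xp) \<and>
     (\<forall>(X :: nat \<Rightarrow> real \<Rightarrow> real^2) (Xt :: nat \<Rightarrow> real \<Rightarrow> real^2) (\<kappa> :: nat \<Rightarrow> real \<Rightarrow> real).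
        (\<forall>m. X m \<in> Vh2 N \<and> \<kappa> m \<in> Vh N \<and> nonzero_edges N (X m)) \<and>
        (\<forall>m\<ge>1. nonzero_edges N (Xt (m + 1)) \<and>
           bgn1_predicted N \<tau> (X m) (Xt (m + 1)) \<and>
           bgn_ac_step N \<tau> (X (m - 1)) (\<kappa> (m - 1)) (X m) (Xt (m + 1)) (X (m + 1)) (\<kappa> (m + 1))) \<and>
        sp_pfem_step N \<tau> (X 0) (X 1) (\<kappa> 1)
        \<longrightarrow> (\<forall>m. area (X m) = area (X 0)))"
proof (intro conjI allI impI)
  fix Xp X Xt Xn \<kappa>p \<kappa> \<kappa>n
  assume "Xp \<in> Vh2 N \<and> X \<in> Vh2 N \<and> \<kappa>p \<in> Vh N \<and> \<kappa> \<in> Vh N \<and>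
        nonzero_edges N Xp \<and> nonzero_edges N X \<and> nonzero_edges N Xt \<and>
        bgn1_predicted N \<tau> X Xt \<and>
        bgn_ac_step N \<tau> Xp \<kappa>p X Xt Xn \<kappa>n"
  then show "area Xn = area Xp"
    using assms by (intro area_bgn_ac_step[of N \<tau> Xp X Xt \<kappa>p Xn \<kappa>n]) (auto simp: bgn1_predicted_def)
next
  fix X :: "nat \<Rightarrow> real \<Rightarrow> real^2" and Xt :: "nat \<Rightarrow> real \<Rightarrow> real^2" and \<kappa> :: "nat \<Rightarrow> real \<Rightarrow> real"
    and m :: nat
  assume *: "(\<forall>m. X m \<in> Vh2 N \<and> \<kappa> m \<in> Vh N \<and> nonzero_edges N (X m)) \<and>
        (\<forall>m\<ge>1. nonzero_edges N (Xt (m + 1)) \<and>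
           bgn1_predicted N \<tau> (X m) (Xt (m + 1)) \<and>
           bgn_ac_step N \<tau> (X (m - 1)) (\<kappa> (m - 1)) (X m) (Xt (m + 1)) (X (m + 1)) (\<kappa> (m + 1))) \<and>
        sp_pfem_step N \<tau> (X 0) (X 1) (\<kappa> 1)"
  have start: "area (X 1) = area (X 0)"
    using * assms by (intro area_sp_pfem_step[of N \<tau> "X 0" "X 1" "\<kappa> 1"]) auto
  have two_steps: "area (X (m + 1)) = area (X (m - 1))" if "m \<ge> 1" for m
    using * assms that
    by (intro area_bgn_ac_step[of N \<tau> "X (m - 1)" "X m" "Xt (m + 1)" "\<kappa> (m - 1)" _ "\<kappa> (m + 1)"])
      (auto simp: bgn1_predicted_def)
  show "area (X m) = area (X 0)"
  proof (induction m rule: less_induct)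
    case (less m)
    consider "m = 0" | "m = 1" | k where "m = Suc (Suc k)"
      by (metis One_nat_def not0_implies_Suc)
    then show ?case
    proof cases
      case 3
      then show ?thesis
        using two_steps[of "Suc k"] less[of k] by simp
    qed (use start in auto)
  qed
qed

end
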